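(* If $\mathfrak k$ is a characteristically nilpotent Lie algebra, then $\mathfrak k$ is never the derived algebra of a $(2,3)$-trivial algebra.
   Context: Lie algebras are real and finite-dimensional. A nilpotent Lie algebra $\mathfrak k$ is characteristically nilpotent if its algebra of derivations $\operatorname{Der}(\mathfrak k)$ acts on $\mathfrak k$ by nilpotent endomorphisms. A Lie algebra $\mathfrak g$ is $(2,3)$-trivial if $b_2(\mathfrak g)=0=b_3(\mathfrak g)$, where $b_n(\mathfrak g)=\dim H^n(\mathfrak g)$ for Lie algebra cohomology with trivial real coefficients. The derived algebra of $\mathfrak g$ is $[\mathfrak g,\mathfrak g]$.
   Formalization: The algebra k is assumed to be nonzero; for k = 0 the claim fails, since the one-dimensional algebra g = R is (2,3)-trivial and has derived algebra 0. *)

theory Defs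
  imports "HOL-Analysis.Analysis" "HOL-Library.Function_Algebras"
begin

text \<open>
  A real finite-dimensional Lie algebra is a finite-dimensional real vector space, given as a
  type, together with a bracket.
\<close>

locale lie_algebra =
  fixes br :: "'a::real_vector \<Rightarrow> 'a \<Rightarrow> 'a"
  assumes finite_dim: "\<exists>B. finite B \<and> span B = (UNIV :: 'a set)"
    and bilinear: "bilinear br"
    and alternating: "br x x = 0"
    and jacobi: "br x (br y z) + br y (br z x) + br z (br x y) = 0"

definition derived_algebra :: "('a::real_vector \<Rightarrow> 'a \<Rightarrow> 'a) \<Rightarrow> 'a set" where
  "derived_algebra br = span {br x y | x y. True}"

fun lower_central :: "('a::real_vector \<Rightarrow> 'a \<Rightarrow> 'a) \<Rightarrow> nat \<Rightarrow> 'a set" where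
  "lower_central br 0 = UNIV"
| "lower_central br (Suc n) = span {br x y | x y. y \<in> lower_central br n}"

definition nilpotent_lie :: "('a::real_vector \<Rightarrow> 'a \<Rightarrow> 'a) \<Rightarrow> bool" where
  "nilpotent_lie br \<longleftrightarrow> (\<exists>n. lower_central br n = {0})"

definition derivations :: "('a::real_vector \<Rightarrow> 'a \<Rightarrow> 'a) \<Rightarrow> ('a \<Rightarrow> 'a) set" where
  "derivations br = {D. linear D \<and> (\<forall>x y. D (br x y) = br (D x) y + br x (D y))}"

definition characteristically_nilpotent :: "('a::real_vector \<Rightarrow> 'a \<Rightarrow> 'a) \<Rightarrow> bool" where
  "characteristically_nilpotent br \<longleftrightarrow>
     nilpotent_lie br \<and> (\<forall>D \<in> derivations br. \<exists>n. \<forall>x. (D ^^ n) x = 0)"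

text \<open>A linear isomorphism of the first Lie algebra onto a subalgebra of the second one.\<close>

definition lie_iso_onto ::
  "('a::real_vector \<Rightarrow> 'a \<Rightarrow> 'a) \<Rightarrow> ('b::real_vector \<Rightarrow> 'b \<Rightarrow> 'b) \<Rightarrow> 'b set \<Rightarrow> ('a \<Rightarrow> 'b) \<Rightarrow> bool"
  where
  "lie_iso_onto br1 br2 S \<phi> \<longleftrightarrow>
     linear \<phi> \<and> bij_betw \<phi> UNIV S \<and> (\<forall>x y. \<phi> (br1 x y) = br2 (\<phi> x) (\<phi> y))"

definition is_derived_algebra_of ::
  "('a::real_vector \<Rightarrow> 'a \<Rightarrow> 'a) \<Rightarrow> ('b::real_vector \<Rightarrow> 'b \<Rightarrow> 'b) \<Rightarrow> bool" where
  "is_derived_algebra_of brk brg \<longleftrightarrow> (\<exists>\<phi>. lie_iso_onto brk brg (derived_algebra brg) \<phi>)"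

instantiation "fun" :: (type, real_vector) real_vector
begin

definition scaleR_fun :: "real \<Rightarrow> ('a \<Rightarrow> 'b) \<Rightarrow> 'a \<Rightarrow> 'b" where
  "scaleR_fun c f = (\<lambda>x. c *\<^sub>R f x)"

instance
  by standard (simp_all add: scaleR_fun_def fun_eq_iff scaleR_add_right scaleR_add_left)

end

text \<open>
  The quotient of a space \<open>V\<close> by a subspace \<open>W\<close>, as the set of cosets. Its zero is \<open>W\<close>, addition
  is the elementwise sum of sets, and \<open>c\<close> times a coset \<open>X\<close> is \<open>(*\<^sub>R) c ` X + W\<close> (the summand \<open>W\<close>
  matters only for \<open>c = 0\<close>).
\<close>

definition quotient_space :: "'v::real_vector set \<Rightarrow> 'v set \<Rightarrow> 'v set set" where
  "quotient_space V W = {v +o W | v. v \<in> V}"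

definition coset_comb :: "'v::real_vector set \<Rightarrow> 'v set set \<Rightarrow> ('v set \<Rightarrow> real) \<Rightarrow> 'v set" where
  "coset_comb W S a = W + (\<Sum>X\<in>S. ((*\<^sub>R) (a X) ` X + W))"

definition quotient_basis :: "'v::real_vector set \<Rightarrow> 'v set \<Rightarrow> 'v set set \<Rightarrow> bool" where
  "quotient_basis V W S \<longleftrightarrow>
     finite S \<and> S \<subseteq> quotient_space V W \<and>
     (\<forall>a. coset_comb W S a = W \<longrightarrow> (\<forall>X\<in>S. a X = 0)) \<and>
     (\<forall>Y \<in> quotient_space V W. \<exists>a. Y = coset_comb W S a)"

text \<open>Meaningful when the quotient is finite-dimensional.\<close>

definition quotient_dim :: "'v::real_vector set \<Rightarrow> 'v set \<Rightarrow> nat" where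
  "quotient_dim V W = card (SOME S. quotient_basis V W S)"

text \<open>
  Chevalley--Eilenberg complex with trivial real coefficients. An \<open>n\<close>-cochain is an alternating
  \<open>n\<close>-linear form, encoded as a function on lists that vanishes on lists of length other than \<open>n\<close>.
\<close>

definition cochains :: "nat \<Rightarrow> ('a::real_vector list \<Rightarrow> real) set" where
  "cochains n = {\<omega>.
     (\<forall>xs. length xs \<noteq> n \<longrightarrow> \<omega> xs = 0) \<and>
     (\<forall>xs i. length xs = n \<and> i < n \<longrightarrow> linear (\<lambda>x. \<omega> (xs[i := x]))) \<and>
     (\<forall>xs i j. length xs = n \<and> i < j \<and> j < n \<and> xs ! i = xs ! j \<longrightarrow> \<omega> xs = 0)}"

text \<open>
  \<open>(d\<omega>)(x\<^sub>0,\<dots>,x\<^sub>n) = \<Sum>\<^bsub>i<j\<^esub> (-1)\<^bsup>i+j\<^esup> \<omega>([x\<^sub>i,x\<^sub>j], x\<^sub>0,\<dots>,x\<^sub>n)\<close> with \<open>x\<^sub>i\<close> and \<open>x\<^sub>j\<close> omitted from the tail.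
\<close>

definition ce_diff :: "('a::real_vector \<Rightarrow> 'a \<Rightarrow> 'a) \<Rightarrow> ('a list \<Rightarrow> real) \<Rightarrow> 'a list \<Rightarrow> real" where
  "ce_diff br \<omega> xs =
     (\<Sum>j<length xs. \<Sum>i<j. (-1) ^ (i + j) * \<omega> (br (xs ! i) (xs ! j) # nths xs (- {i, j})))"

definition cocycles :: "('a::real_vector \<Rightarrow> 'a \<Rightarrow> 'a) \<Rightarrow> nat \<Rightarrow> ('a list \<Rightarrow> real) set" where
  "cocycles br n = {\<omega> \<in> cochains n. ce_diff br \<omega> = 0}"

definition coboundaries :: "('a::real_vector \<Rightarrow> 'a \<Rightarrow> 'a) \<Rightarrow> nat \<Rightarrow> ('a list \<Rightarrow> real) set" where
  "coboundaries br n = (case n of 0 \<Rightarrow> {0} | Suc m \<Rightarrow> ce_diff br ` cochains m)"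

text \<open>The dimension of \<open>H\<^sup>n\<close>, the space of cocycles modulo coboundaries.\<close>

definition betti :: "('a::real_vector \<Rightarrow> 'a \<Rightarrow> 'a) \<Rightarrow> nat \<Rightarrow> nat" where
  "betti br n = quotient_dim (cocycles br n) (coboundaries br n)"

definition trivial_2_3 :: "('a::real_vector \<Rightarrow> 'a \<Rightarrow> 'a) \<Rightarrow> bool" where
  "trivial_2_3 br \<longleftrightarrow> betti br 2 = 0 \<and> betti br 3 = 0"

end

theory Submission
  imports Defs
begin

text \<open>
  Only \<open>b\<^sub>2(\<gg>) = 0\<close> is needed. Suppose \<open>\<kk> = [\<gg>,\<gg>]\<close>. As \<open>\<kk>\<close> is nilpotent and nonzero it is not
  perfect, so \<open>\<kk> \<noteq> \<gg>\<close> and there are a closed 1-form \<open>\<alpha> \<noteq> 0\<close> and \<open>A \<in> \<gg>\<close> with \<open>\<alpha>(A) = 1\<close>. Let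
  \<open>\<hh> = ker \<alpha>\<close>. If a linear form \<open>\<beta>\<close> vanishes on \<open>[\<hh>,\<hh>]\<close>, then \<open>\<alpha> \<and> \<beta>\<close> is closed, hence equal to
  \<open>d\<gamma>\<close>; this says that \<open>\<gamma>\<close> vanishes on \<open>[\<hh>,\<hh>]\<close> and that \<open>\<beta> = -\<gamma> \<circ> ad A\<close> on \<open>\<hh>\<close>. Since \<open>ad A\<close>
  restricts to a derivation of \<open>\<kk>\<close>, it is nilpotent, and iterating gives \<open>\<beta> = 0\<close> on \<open>\<hh>\<close>. Therefore
  \<open>\<hh> = [\<hh>,\<hh>]\<close>, so \<open>\<hh> = \<kk>\<close> is perfect, a contradiction.
\<close>

text \<open>A basis of S stays independent when v is added, so a form can be prescribed as 1 at v
  and 0 on the basis. This yields both \<alpha> and the refuted form \<beta> in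
  \<open>derived_algebra_perfect\<close>.\<close>

lemma exists_linear_form_separating:
  fixes S :: "'a::real_vector set"
  assumes "subspace S" "v \<notin> S"
  shows "\<exists>f :: 'a \<Rightarrow> real. linear f \<and> (\<forall>x\<in>S. f x = 0) \<and> f v = 1"
proof -
  obtain B where B: "B \<subseteq> S" "independent B" "S \<subseteq> span B"
    using maximal_independent_subset[of S] by blast
  have sp: "span B = S" using B assms(1) by (simp add: span_subspace)
  have "independent (insert v B)" using B(2) assms(2) sp by (simp add: independent_insertI)
  then obtain f :: "'a \<Rightarrow> real" where f: "linear f" "\<forall>x\<in>insert v B. f x = (if x = v then 1 else 0)"
    using linear_independent_extend[of "insert v B" "\<lambda>x. if x = v then 1 else 0"] by blast
  have "f b = 0" if "b \<in> B" for b
    using f(2) that B(1) assms(2) by auto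
  then have "f x = 0" if "x \<in> S" for x
    using linear_eq_0_on_span[OF f(1), of B x] that sp by blast
  then show ?thesis using f by auto
qed

section \<open>Quotient spaces\<close>

lemma scaled_coset_plus:
  fixes W :: "'v::real_vector set"
  assumes "subspace W"
  shows "(*\<^sub>R) c ` (v +o W) + W = (c *\<^sub>R v) +o W"
proof (intro set_eqI iffI)
  fix y assume "y \<in> (*\<^sub>R) c ` (v +o W) + W"
  then obtain w w' where "w \<in> W" "w' \<in> W" "y = c *\<^sub>R (v + w) + w'"
    by (auto simp: set_plus_def elt_set_plus_def)
  then have "y = c *\<^sub>R v + (c *\<^sub>R w + w')" "c *\<^sub>R w + w' \<in> W"
    using assms by (auto simp: scaleR_add_right subspace_add subspace_mul)
  then show "y \<in> (c *\<^sub>R v) +o W" by (auto simp: elt_set_plus_def)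
next
  fix y assume "y \<in> (c *\<^sub>R v) +o W"
  then obtain w where w: "w \<in> W" "y = c *\<^sub>R v + w" by (auto simp: elt_set_plus_def)
  have "v \<in> v +o W" using subspace_0[OF assms] by (force simp: elt_set_plus_def)
  then have "c *\<^sub>R v \<in> (*\<^sub>R) c ` (v +o W)" by (rule imageI)
  then show "y \<in> (*\<^sub>R) c ` (v +o W) + W" using w by (auto simp only: set_plus_def)
qed

text \<open>Reduces arithmetic with cosets to arithmetic with representatives. Injectivity matters
  because a sum over the image set counts each coset only once.\<close>

lemma coset_comb_image:
  fixes W :: "'v::real_vector set"
  assumes W: "subspace W" and "finite C" and inj: "inj_on (\<lambda>v. v +o W) C"
  shows "coset_comb W ((\<lambda>v. v +o W) ` C) a = (\<Sum>v\<in>C. a (v +o W) *\<^sub>R v) +o W"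
proof -
  have WW: "W + W = W"
    using W by (auto simp: set_plus_def subspace_add) (metis add_0 subspace_0)
  \<comment> \<open>The leading W turns the empty sum of sets, which is {0}, into the zero coset; in
    the induction step the surplus copy is absorbed by \<open>WW\<close>.\<close>
  have "W + (\<Sum>v\<in>C. b v +o W) = (\<Sum>v\<in>C. b v) +o W" for b :: "'v \<Rightarrow> 'v"
    using \<open>finite C\<close>
  proof induction
    case empty
    then show ?case by (simp add: set_zero_plus2 set_zero_plus)
  next
    case (insert u C)
    have "W + (\<Sum>v\<in>insert u C. b v +o W) = (b u +o W) + (W + (\<Sum>v\<in>C. b v +o W))"
      unfolding sum.insert[OF insert.hyps] by (rule add.left_commute)
    also have "\<dots> = (b u + (\<Sum>v\<in>C. b v)) +o (W + W)"
      unfolding insert.IH by (rule set_plus_rearrange)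
    finally show ?case using insert WW by simp
  qed
  then show ?thesis
    unfolding coset_comb_def by (simp add: sum.reindex[OF inj] scaled_coset_plus[OF W])
qed

lemma coset_eq_iff:
  fixes W :: "'v::real_vector set"
  assumes "subspace W"
  shows "u +o W = v +o W \<longleftrightarrow> u - v \<in> W"
proof
  assume "u +o W = v +o W"
  moreover have "u \<in> u +o W" using subspace_0[OF assms] by (force simp: elt_set_plus_def)
  ultimately show "u - v \<in> W" by (auto simp: elt_set_plus_def)
next
  have sub: "x +o W \<subseteq> y +o W" if "x - y \<in> W" for x y
  proof
    fix z assume "z \<in> x +o W"
    then obtain w where "w \<in> W" "z = x + w" by (auto simp: elt_set_plus_def)
    then have "z = y + ((x - y) + w)" "(x - y) + w \<in> W"
      using that subspace_add[OF assms] by auto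
    then show "z \<in> y +o W" unfolding elt_set_plus_def by blast
  qed
  assume "u - v \<in> W"
  moreover from this have "v - u \<in> W" using subspace_neg[OF assms] by fastforce
  ultimately show "u +o W = v +o W" using sub by blast
qed

text \<open>Among the finite subsets of V that span V together with W, take one of least
  cardinality. Minimality forces independence modulo W, and its cosets form the basis.\<close>

lemma quotient_basis_exists:
  fixes V W :: "'v::real_vector set"
  assumes W: "subspace W" and "finite F" and "V \<subseteq> span F"
  shows "\<exists>S. quotient_basis V W S"
proof -
  let ?P = "\<lambda>C. finite C \<and> C \<subseteq> V \<and> V \<subseteq> span (C \<union> W)"
  obtain B where B: "B \<subseteq> V" "independent B" "V \<subseteq> span B"
    using maximal_independent_subset[of V] by blast
  have "finite B"
    using independent_span_bound[OF assms(2) B(2)] B(1) assms(3) by blast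
  then have "?P B" using B span_mono[of B "B \<union> W"] by blast
  then obtain C where C: "?P C" and least: "\<And>C'. ?P C' \<Longrightarrow> card C \<le> card C'"
    using ex_has_least_nat[of ?P B card] by blast
  have finC: "finite C" using C by blast
  have indep: "a u = 0" if "u \<in> C" "(\<Sum>v\<in>C. a v *\<^sub>R v) \<in> W" for a u
  proof (rule ccontr)
    \<comment> \<open>Dividing by the coefficient of u puts u in the span of the other
      representatives and W, so C without u would be a smaller spanning choice.\<close>
    assume "a u \<noteq> 0"
    let ?X = "(C - {u}) \<union> W"
    have "a u *\<^sub>R u = (\<Sum>v\<in>C. a v *\<^sub>R v) - (\<Sum>v\<in>C - {u}. a v *\<^sub>R v)"
      using finC that(1) by (simp add: sum.remove)
    moreover have "(\<Sum>v\<in>C - {u}. a v *\<^sub>R v) \<in> span ?X"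
      by (intro span_sum span_mul span_base) auto
    ultimately have "a u *\<^sub>R u \<in> span ?X"
      using that(2) by (simp add: span_base span_diff)
    then have "u \<in> span ?X"
      using \<open>a u \<noteq> 0\<close> span_mul[of "a u *\<^sub>R u" ?X "inverse (a u)"] by simp
    then have "C \<union> W \<subseteq> span ?X" by (auto intro: span_base)
    then have "span (C \<union> W) \<subseteq> span ?X" by (simp add: span_minimal)
    then have "card C \<le> card (C - {u})" using C by (intro least) auto
    then show False using card_Diff1_less[OF finC that(1)] by linarith
  qed
  have inj: "inj_on (\<lambda>v. v +o W) C"
  proof (rule inj_onI, rule ccontr)
    fix u v assume uv: "u \<in> C" "v \<in> C" "u +o W = v +o W" "u \<noteq> v"
    \<comment> \<open>Two representatives of one coset give u - v in W, a combination with
      coefficient 1 at u, which \<open>indep\<close> forbids.\<close>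
    define a where "a w = (if w = u then 1 else if w = v then - 1 else 0 :: real)" for w
    have "(\<Sum>w\<in>C. a w *\<^sub>R w) = (\<Sum>w\<in>{u, v}. a w *\<^sub>R w)"
      by (rule sum.mono_neutral_right) (use finC uv in \<open>auto simp: a_def\<close>)
    also have "\<dots> = u - v" using uv by (simp add: a_def)
    finally have "a u = 0" using uv coset_eq_iff[OF W] by (intro indep) auto
    then show False by (simp add: a_def)
  qed
  note comb = coset_comb_image[OF W finC inj]
  have "quotient_basis V W ((\<lambda>v. v +o W) ` C)"
    unfolding quotient_basis_def
  proof (intro conjI allI impI ballI)
    show "finite ((\<lambda>v. v +o W) ` C)" using finC by simp
    show "(\<lambda>v. v +o W) ` C \<subseteq> quotient_space V W"
      using C by (auto simp: quotient_space_def)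
  next
    fix a X assume "coset_comb W ((\<lambda>v. v +o W) ` C) a = W" and X: "X \<in> (\<lambda>v. v +o W) ` C"
    then have "(\<Sum>v\<in>C. a (v +o W) *\<^sub>R v) +o W = 0 +o W"
      by (simp add: comb set_zero_plus)
    then have "(\<Sum>v\<in>C. a (v +o W) *\<^sub>R v) \<in> W" unfolding coset_eq_iff[OF W] by simp
    then show "a X = 0" using indep[where a = "\<lambda>v. a (v +o W)"] X by auto
  next
    fix Y assume "Y \<in> quotient_space V W"
    then obtain v where v: "v \<in> V" "Y = v +o W" by (auto simp: quotient_space_def)
    then have "v \<in> span (C \<union> W)" using C by auto
    then obtain x w where xw: "v = x + w" "x \<in> span C" "w \<in> span W"
      by (auto simp: span_Un)
    then obtain c where c: "x = (\<Sum>u\<in>C. c u *\<^sub>R u)"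
      using span_finite[OF finC] by auto
    \<comment> \<open>Coefficients in \<open>coset_comb\<close> are indexed by cosets, so c is
      transported along the inverse of the injective map from representatives to cosets.\<close>
    define a where "a X = c (the_inv_into C (\<lambda>v. v +o W) X)" for X
    have "(\<Sum>u\<in>C. a (u +o W) *\<^sub>R u) = x"
      unfolding c by (rule sum.cong) (auto simp: a_def the_inv_into_f_f[OF inj])
    moreover have "v - x \<in> W" using xw(1,3) span_minimal[OF subset_refl W] by auto
    ultimately show "\<exists>a. Y = coset_comb W ((\<lambda>v. v +o W) ` C) a"
      using v(2) coset_eq_iff[OF W] comb by metis
  qed
  then show ?thesis by blast
qed

text \<open>The dimension is the cardinality of a set picked by \<open>SOME\<close>, so it carries
  information only once a basis is known to exist. That basis is finite, so cardinality 0 makes it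
  empty, and every coset equals the empty combination W.\<close>

lemma quotient_dim_0_imp_subset:
  fixes V W :: "'v::real_vector set"
  assumes W: "subspace W" and "finite F" and "V \<subseteq> span F" and "quotient_dim V W = 0"
  shows "V \<subseteq> W"
proof
  fix v assume "v \<in> V"
  have basis: "quotient_basis V W (SOME S. quotient_basis V W S)"
    using quotient_basis_exists[OF assms(1-3)] by (rule someI_ex)
  then have "(SOME S. quotient_basis V W S) = {}"
    using assms(4) unfolding quotient_dim_def quotient_basis_def by simp
  then have "quotient_basis V W {}" using basis by simp
  moreover have "v +o W \<in> quotient_space V W" using \<open>v \<in> V\<close> by (auto simp: quotient_space_def)
  ultimately obtain a where "v +o W = coset_comb W {} a" unfolding quotient_basis_def by blast
  then have "v +o W = 0 +o W"
    by (simp add: coset_comb_def set_zero_plus2 set_zero_plus)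
  then show "v \<in> W" unfolding coset_eq_iff[OF W] by simp
qed

section \<open>Cochains\<close>

lemma subspace_cochains: "subspace (cochains n)"
proof (rule subspaceI)
  show "0 \<in> cochains n" by (auto simp: cochains_def linear_zero)
next
  fix f g :: "'a list \<Rightarrow> real" assume "f \<in> cochains n" "g \<in> cochains n"
  then show "f + g \<in> cochains n" by (auto simp: cochains_def intro!: linear_compose_add)
next
  fix c :: real and f :: "'a list \<Rightarrow> real" assume "f \<in> cochains n"
  then show "c *\<^sub>R f \<in> cochains n"
    using linear_compose_scale_right[where c = c]
    by (auto simp: cochains_def scaleR_fun_def simp del: real_scaleR_def)
qed

lemma linear_ce_diff: "linear (ce_diff br)"
proof (rule linearI)
  show "ce_diff br (f + g) = ce_diff br f + ce_diff br g" for f g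
    by (auto simp: fun_eq_iff ce_diff_def algebra_simps sum.distrib)
  show "ce_diff br (c *\<^sub>R f) = c *\<^sub>R ce_diff br f" for c f
    by (auto simp: fun_eq_iff ce_diff_def scaleR_fun_def sum_distrib_left ac_simps)
qed

lemma subspace_coboundaries: "subspace (coboundaries br n)"
  by (cases n)
    (auto simp: coboundaries_def subspace_cochains linear_ce_diff intro: linear_subspace_image)

lemma length_2_eq: "length xs = 2 \<Longrightarrow> xs = [xs ! 0, xs ! 1]"
  by (auto simp: numeral_2_eq_2 length_Suc_conv)

lemma length_3_eq: "length xs = 3 \<Longrightarrow> xs = [xs ! 0, xs ! 1, xs ! 2]"
  by (auto simp: numeral_3_eq_3 length_Suc_conv)

lemma cochains_linear:
  assumes "\<omega> \<in> cochains n" "length xs = n" "i < n"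
  shows "linear (\<lambda>x. \<omega> (xs[i := x]))"
  using assms by (simp add: cochains_def)

lemma cochains_2_linear:
  assumes "\<omega> \<in> cochains 2"
  shows "linear (\<lambda>x. \<omega> [x, y])" "linear (\<lambda>y. \<omega> [x, y])"
proof -
  have *: "linear (\<lambda>z. \<omega> ([x, y][i := z]))" if "i < 2" for i
    by (rule cochains_linear[OF assms _ that]) simp
  show "linear (\<lambda>x. \<omega> [x, y])" using *[of 0] by simp
  show "linear (\<lambda>y. \<omega> [x, y])" using *[of 1] by simp
qed

text \<open>Products of two coordinate functions span all bilinear forms. They are not alternating
  in general, hence containment in a span rather than a basis of the cochains.\<close>

lemma cochains_2_finite_dim:
  assumes "\<exists>B. finite B \<and> span B = (UNIV :: 'a::real_vector set)"
  shows "\<exists>F. finite F \<and> (cochains 2 :: ('a list \<Rightarrow> real) set) \<subseteq> span F"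
proof -
  obtain B0 where B0: "finite B0" "span B0 = (UNIV :: 'a set)" using assms by blast
  obtain B :: "'a set" where B: "B \<subseteq> B0" "independent B" "B0 \<subseteq> span B"
    using maximal_independent_subset[of B0] by blast
  have fin: "finite B" using B(1) B0(1) by (rule finite_subset)
  have spB: "span B = UNIV" using B(3) B0(2) by (metis span_minimal subspace_span top.extremum_unique)
  let ?r = "representation B"
  have expand: "f x = (\<Sum>b\<in>B. ?r x b * f b)" if "linear f" for f :: "'a \<Rightarrow> real" and x
  proof -
    have "x = (\<Sum>b\<in>B. ?r x b *\<^sub>R b)"
      using sum_representation_eq[OF B(2) _ fin] spB by simp
    then have "f x = f (\<Sum>b\<in>B. ?r x b *\<^sub>R b)" by simp
    then show ?thesis using that by (simp add: linear_sum linear_cmul)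
  qed
  define e :: "'a \<times> 'a \<Rightarrow> 'a list \<Rightarrow> real" where
    "e p xs = (if length xs = 2 then ?r (xs ! 0) (fst p) * ?r (xs ! 1) (snd p) else 0)" for p xs
  have "\<omega> \<in> span (e ` (B \<times> B))" if \<omega>: "\<omega> \<in> cochains 2" for \<omega>
  proof -
    have "\<omega> = (\<Sum>p\<in>B \<times> B. \<omega> [fst p, snd p] *\<^sub>R e p)"
    proof
      fix xs :: "'a list"
      have ev: "(\<Sum>p\<in>P. h p) xs = (\<Sum>p\<in>P. h p xs)"
        for P and h :: "'a \<times> 'a \<Rightarrow> 'a list \<Rightarrow> real" and xs
        by (induction P rule: infinite_finite_induct) auto
      show "\<omega> xs = (\<Sum>p\<in>B \<times> B. \<omega> [fst p, snd p] *\<^sub>R e p) xs"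
      proof (cases "length xs = 2")
        case True
        then obtain x y where xs: "xs = [x, y]" using length_2_eq[OF True] by blast
        have "\<omega> [x, y] = (\<Sum>b\<in>B. \<Sum>c\<in>B. ?r x b * (?r y c * \<omega> [b, c]))"
          using expand[OF cochains_2_linear(1)[OF \<omega>]] expand[OF cochains_2_linear(2)[OF \<omega>]]
          by (metis (no_types, lifting) sum.cong sum_distrib_left)
        then show ?thesis
          by (simp add: xs ev scaleR_fun_def e_def sum.cartesian_product split_beta ac_simps)
      next
        case False
        then show ?thesis using \<omega> by (simp add: ev scaleR_fun_def e_def cochains_def)
      qed
    qed
    moreover have "\<dots> \<in> span (e ` (B \<times> B))"
      by (intro span_sum span_mul span_base imageI)
    ultimately show ?thesis by simp
  qed
  then show ?thesis using fin by (intro exI[of _ "e ` (B \<times> B)"]) auto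
qed

section \<open>Wedge products of 1-forms and the differential in low degrees\<close>

definition wedge :: "('a \<Rightarrow> real) \<Rightarrow> ('a \<Rightarrow> real) \<Rightarrow> 'a list \<Rightarrow> real" where
  "wedge \<alpha> \<beta> xs =
     (if length xs = 2 then \<alpha> (xs ! 0) * \<beta> (xs ! 1) - \<alpha> (xs ! 1) * \<beta> (xs ! 0) else 0)"

lemma wedge_cochain:
  assumes "linear \<alpha>" "linear \<beta>"
  shows "wedge \<alpha> \<beta> \<in> cochains 2"
proof -
  have "linear (\<lambda>x. wedge \<alpha> \<beta> (xs[i := x]))" if len: "length xs = 2" and i: "i < 2" for xs i
  proof -
    obtain u v where xs: "xs = [u, v]" using length_2_eq[OF len] by blast
    have "i = 0 \<or> i = 1" using i by auto
    then show ?thesis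
      by (auto simp: xs wedge_def linear_add[OF assms(1)] linear_add[OF assms(2)]
          linear_cmul[OF assms(1)] linear_cmul[OF assms(2)] algebra_simps intro!: linearI)
  qed
  moreover have "wedge \<alpha> \<beta> xs = 0" if "i < j" "j < 2" "xs ! i = xs ! j" for xs i j
  proof -
    have "i = 0" "j = 1" using that(1,2) by auto
    then show ?thesis using that(3) by (simp add: wedge_def)
  qed
  moreover have "wedge \<alpha> \<beta> xs = 0" if "length xs \<noteq> 2" for xs
    using that by (simp add: wedge_def)
  ultimately show ?thesis unfolding cochains_def by blast
qed

lemma ce_diff_pair: "ce_diff br \<omega> [x, y] = - \<omega> [br x y]"
proof -
  have "nths [x, y] (- {0, Suc 0}) = []" by (simp add: nths_Cons)
  then show ?thesis by (simp add: ce_diff_def numeral_2_eq_2)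
qed

lemma ce_diff_triple:
  "ce_diff br \<omega> [x, y, z] = - \<omega> [br x y, z] + \<omega> [br x z, y] - \<omega> [br y z, x]"
proof -
  have "nths [x, y, z] (- {0, Suc 0}) = [z]" "nths [x, y, z] (- {0, Suc (Suc 0)}) = [y]"
    "nths [x, y, z] (- {Suc 0, Suc (Suc 0)}) = [x]"
    by (simp_all add: nths_Cons)
  then show ?thesis by (simp add: ce_diff_def numeral_3_eq_3)
qed

text \<open>Every summand replaces two entries by one bracket, so \<omega> receives a list of the
  wrong length. This settles the lists of irrelevant length when an identity of differentials is
  proved as an equality of functions.\<close>

lemma ce_diff_cochain_eq_0:
  assumes "\<omega> \<in> cochains n" "length xs \<noteq> Suc n"
  shows "ce_diff br \<omega> xs = 0"
proof -
  have "\<omega> (br (xs ! i) (xs ! j) # nths xs (- {i, j})) = 0" if "i < j" "j < length xs" for i j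
  proof -
    have "{k. k < length xs \<and> k \<in> - {i, j}} = {..<length xs} - {i, j}" by auto
    then have "length (nths xs (- {i, j})) = length xs - 2"
      using that by (simp add: length_nths card_Diff_subset)
    then show ?thesis using assms that by (simp add: cochains_def)
  qed
  then show ?thesis by (simp add: ce_diff_def)
qed

section \<open>Lie algebras with vanishing second Betti number\<close>

context lie_algebra
begin

lemma br_linear_right: "linear (br x)"
  using bilinear by (simp add: bilinear_def)

lemma br_linear_left: "linear (\<lambda>x. br x y)"
  using bilinear by (simp add: bilinear_def)

lemma br_anticommute: "br y x = - br x y"
proof -
  have "br (x + y) (x + y) = br x x + br y x + (br x y + br y y)"
    by (simp add: linear_add[OF br_linear_right] linear_add[OF br_linear_left])
  then have "br y x + br x y = 0" by (simp add: alternating)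
  then show ?thesis by (rule eq_neg_iff_add_eq_0[THEN iffD2])
qed

lemma ad_derivation: "br a (br x y) = br (br a x) y + br x (br a y)"
proof -
  have "br x (br y a) = - br x (br a y)"
    using br_anticommute[of y a] by (simp add: linear_neg[OF br_linear_right])
  then show ?thesis
    using jacobi[of a x y] br_anticommute[of y "br a x"] by (simp add: algebra_simps)
qed

lemma br_mem_derived: "br x y \<in> derived_algebra br"
  unfolding derived_algebra_def by (rule span_base) blast

section \<open>Exactness of 2-cocycles and descent along ad a\<close>

lemma two_cocycle_is_coboundary:
  assumes "betti br 2 = 0" "\<omega> \<in> cocycles br 2"
  shows "\<exists>\<eta> \<in> cochains 1. ce_diff br \<eta> = \<omega>"
proof -
  obtain F where F: "finite F" "(cochains 2 :: ('a list \<Rightarrow> real) set) \<subseteq> span F"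
    using cochains_2_finite_dim[OF finite_dim] by blast
  then have "cocycles br 2 \<subseteq> span F" by (auto simp: cocycles_def)
  then have "cocycles br 2 \<subseteq> coboundaries br 2"
    using quotient_dim_0_imp_subset[OF subspace_coboundaries F(1)] assms(1)
    unfolding betti_def by blast
  then show ?thesis using assms(2) by (auto simp: coboundaries_def numeral_2_eq_2)
qed

text \<open>As \<alpha> is closed, d(\<alpha> \<and> \<beta>) is \<alpha> \<and> d\<beta> up to
  sign. Vanishing of \<beta> on brackets of ker \<alpha> makes d\<beta> itself divisible by
  \<alpha>: \<open>\<beta>_br\<close> says d\<beta> = - \<alpha> \<and> (\<beta> o ad a).\<close>

lemma wedge_cocycle:
  assumes \<alpha>: "linear \<alpha>" "\<And>x y. \<alpha> (br x y) = 0" "\<alpha> a = 1"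
    and \<beta>: "linear \<beta>" "\<And>x y. \<alpha> x = 0 \<Longrightarrow> \<alpha> y = 0 \<Longrightarrow> \<beta> (br x y) = 0"
  shows "wedge \<alpha> \<beta> \<in> cocycles br 2"
proof -
  have \<beta>_br: "\<beta> (br x y) = \<alpha> x * \<beta> (br a y) - \<alpha> y * \<beta> (br a x)" for x y
  proof -
    \<comment> \<open>Project both arguments to ker \<alpha> along a, then expand the
      bracket.\<close>
    have "\<beta> (br (x - \<alpha> x *\<^sub>R a) (y - \<alpha> y *\<^sub>R a)) = 0"
      by (rule \<beta>(2)) (simp_all add: linear_diff[OF \<alpha>(1)] linear_cmul[OF \<alpha>(1)] \<alpha>(3))
    then show ?thesis
      by (simp add: linear_diff[OF br_linear_right] linear_diff[OF br_linear_left]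
          linear_cmul[OF br_linear_right] linear_cmul[OF br_linear_left]
          linear_diff[OF \<beta>(1)] linear_add[OF \<beta>(1)] linear_cmul[OF \<beta>(1)] linear_neg[OF \<beta>(1)]
          alternating br_anticommute[of x a] linear_0[OF \<beta>(1)])
  qed
  have cochain: "wedge \<alpha> \<beta> \<in> cochains 2" using \<alpha>(1) \<beta>(1) by (rule wedge_cochain)
  have "ce_diff br (wedge \<alpha> \<beta>) xs = 0" for xs
  proof (cases "length xs = 3")
    case True
    then obtain x y z where xs: "xs = [x, y, z]" using length_3_eq[OF True] by blast
    show ?thesis
      by (simp add: xs ce_diff_triple wedge_def \<alpha>(2) \<beta>_br[of x y] \<beta>_br[of x z] \<beta>_br[of y z]
          algebra_simps)
  next
    case False
    then show ?thesis using ce_diff_cochain_eq_0[OF cochain] by simp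
  qed
  then show ?thesis using cochain by (auto simp: cocycles_def fun_eq_iff)
qed

text \<open>Evaluate d\<eta> = \<alpha> \<and> \<beta> on pairs: two arguments in ker \<alpha> give
  the vanishing condition, and the pair (a, x) gives the factorization. Taking \<gamma> = - \<eta>
  absorbs the sign of the differential.\<close>

lemma form_factors_through_ad:
  assumes "betti br 2 = 0"
    and \<alpha>: "linear (\<alpha> :: 'a \<Rightarrow> real)" "\<And>x y. \<alpha> (br x y) = 0" "\<alpha> a = 1"
    and \<beta>: "linear (\<beta> :: 'a \<Rightarrow> real)" "\<And>x y. \<alpha> x = 0 \<Longrightarrow> \<alpha> y = 0 \<Longrightarrow> \<beta> (br x y) = 0"
  shows "\<exists>\<gamma>. linear \<gamma> \<and> (\<forall>x y. \<alpha> x = 0 \<longrightarrow> \<alpha> y = 0 \<longrightarrow> \<gamma> (br x y) = 0) \<and>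
    (\<forall>x. \<alpha> x = 0 \<longrightarrow> \<beta> x = \<gamma> (br a x))"
proof -
  obtain \<eta> where \<eta>: "\<eta> \<in> cochains 1" "ce_diff br \<eta> = wedge \<alpha> \<beta>"
    using two_cocycle_is_coboundary[OF assms(1) wedge_cocycle[OF \<alpha> \<beta>]] by blast
  \<comment> \<open>The entry of the list [0] is a placeholder that the update overwrites.\<close>
  have "linear (\<lambda>z. \<eta> ([0][0 := z]))"
    by (rule cochains_linear[OF \<eta>(1)]) simp_all
  then have "linear (\<lambda>z. - \<eta> [z])" by (simp add: linear_compose_neg)
  moreover have "- \<eta> [br x y] = \<alpha> x * \<beta> y - \<alpha> y * \<beta> x" for x y
    using fun_cong[OF \<eta>(2), of "[x, y]"] by (simp add: ce_diff_pair wedge_def)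
  ultimately show ?thesis using \<alpha>(3) by (intro exI[of _ "\<lambda>z. - \<eta> [z]"]) auto
qed

text \<open>The form \<gamma> obtained from \<beta> satisfies the same hypotheses as \<beta>, so the
  factorization can be repeated; the induction therefore generalizes over \<beta>.\<close>

lemma form_factors_through_ad_power:
  assumes "betti br 2 = 0"
    and \<alpha>: "linear (\<alpha> :: 'a \<Rightarrow> real)" "\<And>x y. \<alpha> (br x y) = 0" "\<alpha> a = 1"
    and \<beta>: "linear (\<beta> :: 'a \<Rightarrow> real)" "\<And>x y. \<alpha> x = 0 \<Longrightarrow> \<alpha> y = 0 \<Longrightarrow> \<beta> (br x y) = 0"
  shows "\<exists>\<gamma>. linear \<gamma> \<and> (\<forall>x. \<alpha> x = 0 \<longrightarrow> \<beta> x = \<gamma> ((br a ^^ n) x))"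
  using \<beta>
proof (induction n arbitrary: \<beta>)
  case 0
  then show ?case by auto
next
  case (Suc n)
  obtain \<gamma> where \<gamma>: "linear \<gamma>" "\<And>x y. \<alpha> x = 0 \<Longrightarrow> \<alpha> y = 0 \<Longrightarrow> \<gamma> (br x y) = 0"
    "\<And>x. \<alpha> x = 0 \<Longrightarrow> \<beta> x = \<gamma> (br a x)"
    using form_factors_through_ad[OF assms(1) \<alpha> Suc.prems] by blast
  obtain \<delta> where "linear \<delta>" "\<And>x. \<alpha> x = 0 \<Longrightarrow> \<gamma> x = \<delta> ((br a ^^ n) x)"
    using Suc.IH[OF \<gamma>(1,2)] by blast
  \<comment> \<open>Since \<alpha> kills brackets, ad a x lies in ker \<alpha>, where the formula
    for \<gamma> applies.\<close>
  then show ?case using \<gamma>(3) \<alpha>(2) by (intro exI[of _ \<delta>]) (simp add: funpow_Suc_right del: funpow.simps)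
qed

lemma derived_algebra_perfect:
  assumes b2: "betti br 2 = 0"
    and ad_nilpotent: "\<And>a. \<exists>n. \<forall>x. (br a ^^ n) x = 0"
  shows "derived_algebra br =
    span {br x y | x y. x \<in> derived_algebra br \<and> y \<in> derived_algebra br}"
\<comment> \<open>If the whole algebra is perfect, so is its derived algebra; only a proper derived
  algebra admits a nonzero closed 1-form.\<close>
proof (cases "derived_algebra br = UNIV")
  case True
  then show ?thesis by (simp add: derived_algebra_def)
next
  case False
  have sub: "subspace (derived_algebra br)" by (simp add: derived_algebra_def)
  from False obtain a where "a \<notin> derived_algebra br" by blast
  from exists_linear_form_separating[OF sub this]
  obtain \<alpha> :: "'a \<Rightarrow> real" where
    \<alpha>: "linear \<alpha>" "\<And>x. x \<in> derived_algebra br \<Longrightarrow> \<alpha> x = 0" "\<alpha> a = 1" by blast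
  have \<alpha>_br: "\<alpha> (br x y) = 0" for x y using \<alpha>(2) br_mem_derived by blast
  let ?H = "span {br x y | x y. \<alpha> x = 0 \<and> \<alpha> y = 0}"
  obtain n where n: "\<And>x. (br a ^^ n) x = 0" using ad_nilpotent by blast
  \<comment> \<open>A form \<beta> separating x from ?H would factor through the n-th power of ad a,
    which is zero, yet \<beta> is 1 at x.\<close>
  have ker: "x \<in> ?H" if "\<alpha> x = 0" for x
  proof (rule ccontr)
    assume "x \<notin> ?H"
    from exists_linear_form_separating[OF subspace_span this]
    obtain \<beta> :: "'a \<Rightarrow> real" where \<beta>: "linear \<beta>" "\<And>y. y \<in> ?H \<Longrightarrow> \<beta> y = 0" "\<beta> x = 1" by blast
    have "\<beta> (br u v) = 0" if "\<alpha> u = 0" "\<alpha> v = 0" for u v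
      by (rule \<beta>(2)) (use that in \<open>blast intro: span_base\<close>)
    then obtain \<gamma> where "linear \<gamma>" "\<forall>x. \<alpha> x = 0 \<longrightarrow> \<beta> x = \<gamma> ((br a ^^ n) x)"
      using form_factors_through_ad_power[OF b2 \<alpha>(1) \<alpha>_br \<alpha>(3) \<beta>(1)] by blast
    then show False using that \<beta>(3) n by (simp add: linear_0)
  qed
  have "?H \<subseteq> derived_algebra br"
    unfolding derived_algebra_def by (rule span_mono) blast
  \<comment> \<open>The inclusions ker \<alpha> in ?H in the derived algebra in ker \<alpha> close
    up, so membership in the derived algebra and vanishing of \<alpha> are interchangeable in the
    final rewriting.\<close>
  then have mem: "x \<in> derived_algebra br \<longleftrightarrow> \<alpha> x = 0" for x using ker \<alpha>(2) by blast
  have "derived_algebra br \<subseteq> ?H" using ker mem by blast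
  with \<open>?H \<subseteq> derived_algebra br\<close> have "derived_algebra br = ?H" by (rule subset_antisym[rotated])
  then show ?thesis unfolding mem .
qed

end

section \<open>Derived algebras\<close>

text \<open>For a perfect algebra the lower central series never leaves the whole space. The zero
  algebra is both nilpotent and perfect and has to be excluded.\<close>

lemma nilpotent_not_perfect:
  fixes br :: "'a::real_vector \<Rightarrow> 'a \<Rightarrow> 'a"
  assumes "nilpotent_lie br" "(UNIV :: 'a set) \<noteq> {0}"
  shows "derived_algebra br \<noteq> UNIV"
proof
  assume "derived_algebra br = UNIV"
  then have "lower_central br n = UNIV" for n
    by (induction n) (simp_all add: derived_algebra_def)
  then show False using assms by (auto simp: nilpotent_lie_def)
qed

text \<open>The derived algebra is an ideal, so ad a restricts to it and pulls back along \<phi> to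
  a derivation D of the first algebra, nilpotent by hypothesis.\<close>

lemma ad_nilpotent_of_derived_iso:
  assumes "lie_algebra brg" and iso: "lie_iso_onto brk brg (derived_algebra brg) \<phi>"
    and der: "\<forall>D \<in> derivations brk. \<exists>n. \<forall>x. (D ^^ n) x = 0"
  shows "\<exists>n. \<forall>x. (brg a ^^ n) x = 0"
proof -
  interpret lie_algebra brg by fact
  have \<phi>: "linear \<phi>" "inj \<phi>" "range \<phi> = derived_algebra brg"
    "\<And>x y. \<phi> (brk x y) = brg (\<phi> x) (\<phi> y)"
    using iso by (auto simp: lie_iso_onto_def bij_betw_def)
  define D where "D x = inv \<phi> (brg a (\<phi> x))" for x
  have D: "\<phi> (D x) = brg a (\<phi> x)" for x
    unfolding D_def by (rule f_inv_into_f) (simp add: \<phi>(3) br_mem_derived)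
  have "linear D"
  proof (rule linearI)
    show "D (x + y) = D x + D y" for x y
      by (rule injD[OF \<phi>(2)]) (simp add: D linear_add[OF \<phi>(1)] linear_add[OF br_linear_right])
    show "D (c *\<^sub>R x) = c *\<^sub>R D x" for c x
      by (rule injD[OF \<phi>(2)]) (simp add: D linear_cmul[OF \<phi>(1)] linear_cmul[OF br_linear_right])
  qed
  moreover have "D (brk x y) = brk (D x) y + brk x (D y)" for x y
    by (rule injD[OF \<phi>(2)]) (simp add: D linear_add[OF \<phi>(1)] \<phi>(4) ad_derivation[of a "\<phi> x" "\<phi> y"])
  ultimately have "D \<in> derivations brk" by (simp add: derivations_def)
  then obtain n where n: "\<And>x. (D ^^ n) x = 0" using der by blast
  have pow: "\<phi> ((D ^^ m) x) = (brg a ^^ m) (\<phi> x)" for m x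
    by (induction m) (simp_all add: D)
  \<comment> \<open>D controls ad a only on the derived algebra; one further application of ad a
    first moves an arbitrary x into it.\<close>
  have "(brg a ^^ Suc n) x = 0" for x
  proof -
    obtain y where "brg a x = \<phi> y" using \<phi>(3) br_mem_derived by blast
    then have "(brg a ^^ Suc n) x = \<phi> ((D ^^ n) y)"
      by (simp add: funpow_Suc_right pow del: funpow.simps)
    then show ?thesis by (simp add: n linear_0[OF \<phi>(1)])
  qed
  then show ?thesis by blast
qed

theorem corollary4p7:
  fixes brk :: "'k::real_vector \<Rightarrow> 'k \<Rightarrow> 'k"
    and brg :: "'g::real_vector \<Rightarrow> 'g \<Rightarrow> 'g"
  assumes "lie_algebra brk"
    and "characteristically_nilpotent brk"
    and "(UNIV :: 'k set) \<noteq> {0}"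
    and "lie_algebra brg"
    and "trivial_2_3 brg"
  shows "\<not> is_derived_algebra_of brk brg"
proof
  assume "is_derived_algebra_of brk brg"
  then obtain \<phi> where iso: "lie_iso_onto brk brg (derived_algebra brg) \<phi>"
    by (auto simp: is_derived_algebra_of_def)
  then have \<phi>: "linear \<phi>" "inj \<phi>" "range \<phi> = derived_algebra brg"
    "\<And>x y. \<phi> (brk x y) = brg (\<phi> x) (\<phi> y)"
    by (auto simp: lie_iso_onto_def bij_betw_def)
  have "\<exists>n. \<forall>x. (brg a ^^ n) x = 0" for a
    using ad_nilpotent_of_derived_iso[OF assms(4) iso] assms(2)
    by (auto simp: characteristically_nilpotent_def)
  \<comment> \<open>Perfectness of the derived algebra is pulled back: brackets of images are images
    of brackets, \<phi> commutes with spans, and injectivity cancels it.\<close>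
  then have "range \<phi> = span {brg x y | x y. x \<in> range \<phi> \<and> y \<in> range \<phi>}"
    using lie_algebra.derived_algebra_perfect[OF assms(4)] assms(5) \<phi>(3)
    by (simp add: trivial_2_3_def)
  also have "{brg x y | x y. x \<in> range \<phi> \<and> y \<in> range \<phi>} = \<phi> ` {brk x y | x y. True}"
  proof -
    have "{brg x y | x y. x \<in> range \<phi> \<and> y \<in> range \<phi>} = {\<phi> (brk x y) | x y. True}"
      unfolding \<phi>(4) by blast
    then show ?thesis by blast
  qed
  also have "span \<dots> = \<phi> ` derived_algebra brk"
    by (simp add: derived_algebra_def linear_span_image[OF \<phi>(1)])
  finally have "derived_algebra brk = UNIV" by (simp add: inj_image_eq_iff[OF \<phi>(2)])
  then show False
    using nilpotent_not_perfect assms(2,3) by (auto simp: characteristically_nilpotent_def)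
qed

end
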